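(* Let $k$ be a field and let $(R,\mathfrak m)$ be a local $k$-algebra. For every ideal $\mathfrak a\subset R$, $$\bigcap_{m\in\mathbb N}\mathfrak a^{m\text{-jc}}=\mathfrak a^{\mathrm{ac}},$$ i.e. the intersection of the $m$-jet closures of $\mathfrak a$ over all finite $m$ equals the arc closure of $\mathfrak a$.
   Context: $\mathbb N$ is the set of nonnegative integers; for a $k$-algebra $A$ write $A[t]/(t^{\infty+1}):=A[[t]]$. Local rings are not assumed Noetherian. For $m\in\mathbb N\cup\{\infty\}$ let $R_m$ be the $k$-algebra representing the functor $A\mapsto \mathrm{Hom}_{k\text{-alg}}(R,A[t]/(t^{m+1}))$ on $k$-algebras (the coordinate ring of the $m$-jet scheme, resp. arc space, of $\mathrm{Spec}\,R$). Write the universal homomorphism as $R\to R_m[t]/(t^{m+1})$, $f\mapsto \sum_i D_i(f)t^i$ (sum over integers $0\le i<m+1$); $D_0\colon R\to R_m$ is a ring homomorphism making $R_m$ an $R$-algebra, and $\mathfrak m R_m$ is formed accordingly. For an ideal $\mathfrak a\subset R$ put $\mathfrak a_m:=(D_i(f)\mid f\in\mathfrak a,\ 0\le i<m+1)\subset R_m$. The $m$-jet closure of $\mathfrak a$ is $$\mathfrak a^{m\text{-jc}}:=\{f\in R\mid (f)_m\subset \mathfrak a_m+\mathfrak m R_m\}.$$ For $m=\infty$ it is called the arc closure and denoted $\mathfrak a^{\mathrm{ac}}:=\mathfrak a^{\infty\text{-jc}}$. *)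

theory Defs
  imports "HOL-Algebra.Algebra" "HOL-Library.Extended_Nat"
begin

section \<open>Algebra homomorphisms and truncated power series\<close>

definition algebra_hom ::
    "('k, 'p) ring_scheme \<Rightarrow> ('k, 'a, 'q) module_scheme \<Rightarrow> ('k, 'b, 'r) module_scheme \<Rightarrow> ('a \<Rightarrow> 'b) set"
  where "algebra_hom K A B =
    {h \<in> ring_hom A B. \<forall>c\<in>carrier K. \<forall>x\<in>carrier A. h (c \<odot>\<^bsub>A\<^esub> x) = c \<odot>\<^bsub>B\<^esub> h x}"

text \<open>
  \<open>A[t]/(t^(m+1))\<close> for \<open>m\<close> finite and \<open>A[[t]]\<close> for \<open>m = \<infinity>\<close>. An element is its sequence of
  coefficients, which is \<open>\<zero>\<close> beyond index \<open>m\<close>. Here and below the index range \<open>0 \<le> i < m + 1\<close> is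
  written \<open>enat i \<le> m\<close>.
\<close>
definition truncated_series ::
    "enat \<Rightarrow> ('k, 'b, 'r) module_scheme \<Rightarrow> ('k, nat \<Rightarrow> 'b) module"
  where "truncated_series m A =
    \<lparr>carrier = {a. \<forall>i. if enat i \<le> m then a i \<in> carrier A else a i = \<zero>\<^bsub>A\<^esub>},
     monoid.mult = (\<lambda>a b i. if enat i \<le> m then (\<Oplus>\<^bsub>A\<^esub>j\<in>{..i}. a j \<otimes>\<^bsub>A\<^esub> b (i - j)) else \<zero>\<^bsub>A\<^esub>),
     one = (\<lambda>i. if i = 0 then \<one>\<^bsub>A\<^esub> else \<zero>\<^bsub>A\<^esub>),
     ring.zero = (\<lambda>i. \<zero>\<^bsub>A\<^esub>),
     add = (\<lambda>a b i. a i \<oplus>\<^bsub>A\<^esub> b i),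
     smult = (\<lambda>c a i. c \<odot>\<^bsub>A\<^esub> a i)\<rparr>"

section \<open>The coordinate ring of the jet scheme\<close>

text \<open>
  The algebra \<open>R\<^sub>m\<close> is presented by generators and relations: terms in the symbols \<open>D\<^sub>i f\<close> and the
  scalars, modulo the least congruence that contains the axioms of a commutative \<open>K\<close>-algebra and
  the relations saying that \<open>f \<mapsto> \<Sum>\<^sub>i D\<^sub>i(f) t^i\<close> is a homomorphism of \<open>K\<close>-algebras. That it represents
  the functor \<open>A \<mapsto> Hom(R, A[t]/(t^(m+1)))\<close> is proved as \<open>jet_algebra_represents\<close> below.
\<close>

datatype ('k, 'a) jet_term =
    JScalar 'k
  | JD nat 'a
  | JAdd "('k, 'a) jet_term" "('k, 'a) jet_term"
  | JMul "('k, 'a) jet_term" "('k, 'a) jet_term"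
  | JNeg "('k, 'a) jet_term"

primrec jet_sum :: "(nat \<Rightarrow> ('k, 'a) jet_term) \<Rightarrow> nat \<Rightarrow> ('k, 'a) jet_term" where
  "jet_sum g 0 = g 0"
| "jet_sum g (Suc n) = JAdd (jet_sum g n) (g (Suc n))"

inductive_set jet_terms ::
    "('k, 'p) ring_scheme \<Rightarrow> ('k, 'a, 'q) module_scheme \<Rightarrow> enat \<Rightarrow> ('k, 'a) jet_term set"
  for K :: "('k, 'p) ring_scheme" and R :: "('k, 'a, 'q) module_scheme" and m :: enat where
  scalar: "c \<in> carrier K \<Longrightarrow> JScalar c \<in> jet_terms K R m"
| gen: "enat i \<le> m \<Longrightarrow> f \<in> carrier R \<Longrightarrow> JD i f \<in> jet_terms K R m"
| add: "s \<in> jet_terms K R m \<Longrightarrow> t \<in> jet_terms K R m \<Longrightarrow> JAdd s t \<in> jet_terms K R m"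
| mul: "s \<in> jet_terms K R m \<Longrightarrow> t \<in> jet_terms K R m \<Longrightarrow> JMul s t \<in> jet_terms K R m"
| neg: "t \<in> jet_terms K R m \<Longrightarrow> JNeg t \<in> jet_terms K R m"

inductive jet_rel ::
    "('k, 'p) ring_scheme \<Rightarrow> ('k, 'a, 'q) module_scheme \<Rightarrow> enat \<Rightarrow>
      ('k, 'a) jet_term \<Rightarrow> ('k, 'a) jet_term \<Rightarrow> bool"
  for K :: "('k, 'p) ring_scheme" and R :: "('k, 'a, 'q) module_scheme" and m :: enat where
  refl: "t \<in> jet_terms K R m \<Longrightarrow> jet_rel K R m t t"
| sym: "jet_rel K R m s t \<Longrightarrow> jet_rel K R m t s"
| trans: "jet_rel K R m s t \<Longrightarrow> jet_rel K R m t u \<Longrightarrow> jet_rel K R m s u"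
| add_cong: "jet_rel K R m s s' \<Longrightarrow> jet_rel K R m t t' \<Longrightarrow> jet_rel K R m (JAdd s t) (JAdd s' t')"
| mul_cong: "jet_rel K R m s s' \<Longrightarrow> jet_rel K R m t t' \<Longrightarrow> jet_rel K R m (JMul s t) (JMul s' t')"
| neg_cong: "jet_rel K R m t t' \<Longrightarrow> jet_rel K R m (JNeg t) (JNeg t')"
| a_assoc: "s \<in> jet_terms K R m \<Longrightarrow> t \<in> jet_terms K R m \<Longrightarrow> u \<in> jet_terms K R m \<Longrightarrow>
    jet_rel K R m (JAdd (JAdd s t) u) (JAdd s (JAdd t u))"
| a_comm: "s \<in> jet_terms K R m \<Longrightarrow> t \<in> jet_terms K R m \<Longrightarrow>
    jet_rel K R m (JAdd s t) (JAdd t s)"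
| l_zero: "t \<in> jet_terms K R m \<Longrightarrow> jet_rel K R m (JAdd (JScalar \<zero>\<^bsub>K\<^esub>) t) t"
| l_neg: "t \<in> jet_terms K R m \<Longrightarrow> jet_rel K R m (JAdd (JNeg t) t) (JScalar \<zero>\<^bsub>K\<^esub>)"
| m_assoc: "s \<in> jet_terms K R m \<Longrightarrow> t \<in> jet_terms K R m \<Longrightarrow> u \<in> jet_terms K R m \<Longrightarrow>
    jet_rel K R m (JMul (JMul s t) u) (JMul s (JMul t u))"
| m_comm: "s \<in> jet_terms K R m \<Longrightarrow> t \<in> jet_terms K R m \<Longrightarrow>
    jet_rel K R m (JMul s t) (JMul t s)"
| l_one: "t \<in> jet_terms K R m \<Longrightarrow> jet_rel K R m (JMul (JScalar \<one>\<^bsub>K\<^esub>) t) t"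
| l_distr: "s \<in> jet_terms K R m \<Longrightarrow> t \<in> jet_terms K R m \<Longrightarrow> u \<in> jet_terms K R m \<Longrightarrow>
    jet_rel K R m (JMul (JAdd s t) u) (JAdd (JMul s u) (JMul t u))"
| scalar_add: "c \<in> carrier K \<Longrightarrow> d \<in> carrier K \<Longrightarrow>
    jet_rel K R m (JScalar (c \<oplus>\<^bsub>K\<^esub> d)) (JAdd (JScalar c) (JScalar d))"
| scalar_mul: "c \<in> carrier K \<Longrightarrow> d \<in> carrier K \<Longrightarrow>
    jet_rel K R m (JScalar (c \<otimes>\<^bsub>K\<^esub> d)) (JMul (JScalar c) (JScalar d))"
| D_add: "enat i \<le> m \<Longrightarrow> f \<in> carrier R \<Longrightarrow> g \<in> carrier R \<Longrightarrow>
    jet_rel K R m (JD i (f \<oplus>\<^bsub>R\<^esub> g)) (JAdd (JD i f) (JD i g))"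
| D_smult: "enat i \<le> m \<Longrightarrow> c \<in> carrier K \<Longrightarrow> f \<in> carrier R \<Longrightarrow>
    jet_rel K R m (JD i (c \<odot>\<^bsub>R\<^esub> f)) (JMul (JScalar c) (JD i f))"
| D_mult: "enat i \<le> m \<Longrightarrow> f \<in> carrier R \<Longrightarrow> g \<in> carrier R \<Longrightarrow>
    jet_rel K R m (JD i (f \<otimes>\<^bsub>R\<^esub> g)) (jet_sum (\<lambda>j. JMul (JD j f) (JD (i - j) g)) i)"
| D_one: "enat i \<le> m \<Longrightarrow>
    jet_rel K R m (JD i \<one>\<^bsub>R\<^esub>) (JScalar (if i = 0 then \<one>\<^bsub>K\<^esub> else \<zero>\<^bsub>K\<^esub>))"

definition jet_class ::
    "('k, 'p) ring_scheme \<Rightarrow> ('k, 'a, 'q) module_scheme \<Rightarrow> enat \<Rightarrow>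
      ('k, 'a) jet_term \<Rightarrow> ('k, 'a) jet_term set"
  where "jet_class K R m t = {u. jet_rel K R m t u}"

definition jet_algebra ::
    "('k, 'p) ring_scheme \<Rightarrow> ('k, 'a, 'q) module_scheme \<Rightarrow> enat \<Rightarrow>
      ('k, ('k, 'a) jet_term set) module"
  where "jet_algebra K R m =
    \<lparr>carrier = jet_class K R m ` jet_terms K R m,
     monoid.mult = (\<lambda>P Q. \<Union>s\<in>P. \<Union>t\<in>Q. jet_class K R m (JMul s t)),
     one = jet_class K R m (JScalar \<one>\<^bsub>K\<^esub>),
     ring.zero = jet_class K R m (JScalar \<zero>\<^bsub>K\<^esub>),
     add = (\<lambda>P Q. \<Union>s\<in>P. \<Union>t\<in>Q. jet_class K R m (JAdd s t)),
     smult = (\<lambda>c P. \<Union>t\<in>P. jet_class K R m (JMul (JScalar c) t))\<rparr>"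

definition jet_D ::
    "('k, 'p) ring_scheme \<Rightarrow> ('k, 'a, 'q) module_scheme \<Rightarrow> enat \<Rightarrow>
      nat \<Rightarrow> 'a \<Rightarrow> ('k, 'a) jet_term set"
  where "jet_D K R m i f = jet_class K R m (JD i f)"

definition universal_jet ::
    "('k, 'p) ring_scheme \<Rightarrow> ('k, 'a, 'q) module_scheme \<Rightarrow> enat \<Rightarrow>
      'a \<Rightarrow> nat \<Rightarrow> ('k, 'a) jet_term set"
  where "universal_jet K R m f =
    (\<lambda>i. if enat i \<le> m then jet_D K R m i f else \<zero>\<^bsub>jet_algebra K R m\<^esub>)"

section \<open>Jet closures\<close>

definition local_ring :: "('a, 'q) ring_scheme \<Rightarrow> 'a set \<Rightarrow> bool"
  where "local_ring R \<mm> \<longleftrightarrow> cring R \<and> {I. maximalideal I R} = {\<mm>}"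

definition jet_ideal ::
    "('k, 'p) ring_scheme \<Rightarrow> ('k, 'a, 'q) module_scheme \<Rightarrow> enat \<Rightarrow>
      'a set \<Rightarrow> ('k, 'a) jet_term set set"
  where "jet_ideal K R m \<aa> =
    Idl\<^bsub>jet_algebra K R m\<^esub> {jet_D K R m i f | i f. f \<in> \<aa> \<and> enat i \<le> m}"

definition jet_extension ::
    "('k, 'p) ring_scheme \<Rightarrow> ('k, 'a, 'q) module_scheme \<Rightarrow> enat \<Rightarrow>
      'a set \<Rightarrow> ('k, 'a) jet_term set set"
  where "jet_extension K R m I = Idl\<^bsub>jet_algebra K R m\<^esub> (jet_D K R m 0 ` I)"

definition jet_closure ::
    "('k, 'p) ring_scheme \<Rightarrow> ('k, 'a, 'q) module_scheme \<Rightarrow> 'a set \<Rightarrow> enat \<Rightarrow> 'a set \<Rightarrow> 'a set"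
  where "jet_closure K R \<mm> m \<aa> =
    {f \<in> carrier R. jet_ideal K R m (PIdl\<^bsub>R\<^esub> f) \<subseteq>
        jet_ideal K R m \<aa> <+>\<^bsub>jet_algebra K R m\<^esub> jet_extension K R m \<mm>}"

definition arc_closure ::
    "('k, 'p) ring_scheme \<Rightarrow> ('k, 'a, 'q) module_scheme \<Rightarrow> 'a set \<Rightarrow> 'a set \<Rightarrow> 'a set"
  where "arc_closure K R \<mm> \<aa> = jet_closure K R \<mm> \<infinity> \<aa>"

section \<open>The jet algebra represents the jet functor\<close>

lemma (in cring) truncated_convolution_assoc:
  fixes n :: nat
  assumes "k \<le> n"
    and a: "\<And>i. i \<le> n \<Longrightarrow> a i \<in> carrier R"
    and b: "\<And>i. i \<le> n \<Longrightarrow> b i \<in> carrier R"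
    and c: "\<And>i. i \<le> n \<Longrightarrow> c i \<in> carrier R"
  shows "(\<Oplus>j\<in>{..k}. (\<Oplus>i\<in>{..j}. a i \<otimes> b (j - i)) \<otimes> c (n - j))
    = (\<Oplus>j\<in>{..k}. a j \<otimes> (\<Oplus>i\<in>{..k - j}. b i \<otimes> c (n - j - i)))"
  using assms(1)
proof (induction k)
  case 0
  then show ?case by (simp add: a b c m_assoc)
next
  case (Suc k)
  have in1: "(\<Oplus>i\<in>{..j}. a i \<otimes> b (j - i)) \<in> carrier R" if "j \<le> n" for j
    using that by (intro finsum_closed) (auto simp: a b)
  have in2: "(\<Oplus>i\<in>{..l - j}. b i \<otimes> c (n - j - i)) \<in> carrier R" if "l \<le> n" for l j
    using that by (intro finsum_closed) (auto simp: b c)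
  have step: "a j \<otimes> (\<Oplus>i\<in>{..Suc k - j}. b i \<otimes> c (n - j - i))
      = a j \<otimes> b (Suc k - j) \<otimes> c (n - Suc k) \<oplus> a j \<otimes> (\<Oplus>i\<in>{..k - j}. b i \<otimes> c (n - j - i))"
    if "j \<le> k" for j
  proof -
    have eq: "Suc k - j = Suc (k - j)" using that by simp
    have idx: "n - j - Suc (k - j) = n - Suc k" using that Suc.prems by simp
    have "(\<Oplus>i\<in>{..Suc (k - j)}. b i \<otimes> c (n - j - i))
        = b (Suc (k - j)) \<otimes> c (n - j - Suc (k - j)) \<oplus> (\<Oplus>i\<in>{..k - j}. b i \<otimes> c (n - j - i))"
      using that Suc.prems by (intro finsum_Suc) (auto simp: Pi_def b c)
    moreover have "a j \<in> carrier R" "b (Suc (k - j)) \<in> carrier R" "c (n - Suc k) \<in> carrier R"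
      "(\<Oplus>i\<in>{..k - j}. b i \<otimes> c (n - j - i)) \<in> carrier R"
      using that Suc.prems in2 by (auto simp: a b c)
    ultimately show ?thesis
      unfolding eq idx by (simp add: r_distr m_assoc)
  qed
  have "(\<Oplus>j\<in>{..Suc k}. (\<Oplus>i\<in>{..j}. a i \<otimes> b (j - i)) \<otimes> c (n - j))
      = (\<Oplus>i\<in>{..Suc k}. a i \<otimes> b (Suc k - i)) \<otimes> c (n - Suc k)
        \<oplus> (\<Oplus>j\<in>{..k}. (\<Oplus>i\<in>{..j}. a i \<otimes> b (j - i)) \<otimes> c (n - j))"
    using Suc.prems by (intro finsum_Suc) (auto simp: in1 c)
  also have "(\<Oplus>j\<in>{..k}. (\<Oplus>i\<in>{..j}. a i \<otimes> b (j - i)) \<otimes> c (n - j))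
      = (\<Oplus>j\<in>{..k}. a j \<otimes> (\<Oplus>i\<in>{..k - j}. b i \<otimes> c (n - j - i)))"
    using Suc by simp
  also have "(\<Oplus>i\<in>{..Suc k}. a i \<otimes> b (Suc k - i)) \<otimes> c (n - Suc k)
      = (\<Oplus>i\<in>{..Suc k}. a i \<otimes> b (Suc k - i) \<otimes> c (n - Suc k))"
    using Suc.prems by (intro finsum_ldistr) (auto simp: a b c)
  also have "\<dots> = a (Suc k) \<otimes> b 0 \<otimes> c (n - Suc k)
      \<oplus> (\<Oplus>i\<in>{..k}. a i \<otimes> b (Suc k - i) \<otimes> c (n - Suc k))"
    using Suc.prems by (subst finsum_Suc) (auto simp: Pi_def a b c)
  finally have "(\<Oplus>j\<in>{..Suc k}. (\<Oplus>i\<in>{..j}. a i \<otimes> b (j - i)) \<otimes> c (n - j))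
      = (a (Suc k) \<otimes> b 0 \<otimes> c (n - Suc k)
         \<oplus> (\<Oplus>i\<in>{..k}. a i \<otimes> b (Suc k - i) \<otimes> c (n - Suc k)))
        \<oplus> (\<Oplus>j\<in>{..k}. a j \<otimes> (\<Oplus>i\<in>{..k - j}. b i \<otimes> c (n - j - i)))" .
  also have "\<dots> = a (Suc k) \<otimes> b 0 \<otimes> c (n - Suc k)
      \<oplus> ((\<Oplus>i\<in>{..k}. a i \<otimes> b (Suc k - i) \<otimes> c (n - Suc k))
        \<oplus> (\<Oplus>j\<in>{..k}. a j \<otimes> (\<Oplus>i\<in>{..k - j}. b i \<otimes> c (n - j - i))))"
    using Suc.prems by (intro a_assoc finsum_closed) (auto simp: a b c in2)
  also have "(\<Oplus>i\<in>{..k}. a i \<otimes> b (Suc k - i) \<otimes> c (n - Suc k))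
        \<oplus> (\<Oplus>j\<in>{..k}. a j \<otimes> (\<Oplus>i\<in>{..k - j}. b i \<otimes> c (n - j - i)))
      = (\<Oplus>j\<in>{..k}. a j \<otimes> b (Suc k - j) \<otimes> c (n - Suc k)
          \<oplus> a j \<otimes> (\<Oplus>i\<in>{..k - j}. b i \<otimes> c (n - j - i)))"
    using Suc.prems by (intro finsum_addf[symmetric]) (auto simp: a b c in2)
  also have "\<dots> = (\<Oplus>j\<in>{..k}. a j \<otimes> (\<Oplus>i\<in>{..Suc k - j}. b i \<otimes> c (n - j - i)))"
    using Suc.prems
    by (intro finsum_cong' refl funcsetI m_closed in2 a step[symmetric]) auto
  also have "a (Suc k) \<otimes> b 0 \<otimes> c (n - Suc k) \<oplus> \<dots>
      = (\<Oplus>j\<in>{..Suc k}. a j \<otimes> (\<Oplus>i\<in>{..Suc k - j}. b i \<otimes> c (n - j - i)))"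
    using Suc.prems
    by (subst finsum_Suc) (auto simp: Pi_def in2 a b c m_assoc)
  finally show ?case .
qed

lemma (in cring) convolution_comm:
  fixes n :: nat
  assumes a: "\<And>i. i \<le> n \<Longrightarrow> a i \<in> carrier R"
    and b: "\<And>i. i \<le> n \<Longrightarrow> b i \<in> carrier R"
  shows "(\<Oplus>j\<in>{..n}. a j \<otimes> b (n - j)) = (\<Oplus>j\<in>{..n}. b j \<otimes> a (n - j))"
proof -
  have bij: "bij_betw (\<lambda>j. n - j) {..n} {..n}"
    by (rule bij_betwI[where g = "\<lambda>j. n - j"]) auto
  have "(\<Oplus>j\<in>{..n}. a j \<otimes> b (n - j)) = (\<Oplus>j\<in>{..n}. a (n - j) \<otimes> b (n - (n - j)))"
    using bij unfolding bij_betw_def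
    by (subst finsum_reindex[symmetric]) (auto simp: a b)
  also have "\<dots> = (\<Oplus>j\<in>{..n}. b j \<otimes> a (n - j))"
    by (intro finsum_cong') (auto simp: a b m_comm)
  finally show ?thesis .
qed

lemma truncated_series_algebra:
  assumes "algebra K A"
  shows "algebra K (truncated_series m A)"
proof -
  interpret A: cring A by (rule algebra.M_cring[OF assms])
  interpret algebra K A by (rule assms)
  let ?T = "truncated_series m A"
  note T = truncated_series_def
  have carr: "a i \<in> carrier A" if "a \<in> carrier ?T" for a i
    using that by (auto simp: T split: if_splits)
  have zero: "a i = \<zero>\<^bsub>A\<^esub>" if "a \<in> carrier ?T" "\<not> enat i \<le> m" for a i
    using that by (auto simp: T split: if_splits)
  have down: "enat j \<le> m" if "enat i \<le> m" "j \<le> i" for i j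
    using that by (meson enat_ord_simps(1) order_trans)
  have conv: "(\<Oplus>\<^bsub>A\<^esub>j\<in>{..i}. a j \<otimes>\<^bsub>A\<^esub> b (i - j)) \<in> carrier A"
    if "a \<in> carrier ?T" "b \<in> carrier ?T" for a b and i :: nat
    using that by (intro A.finsum_closed) (auto simp: carr)
  have mul: "a \<otimes>\<^bsub>?T\<^esub> b = (\<lambda>i. if enat i \<le> m then (\<Oplus>\<^bsub>A\<^esub>j\<in>{..i}. a j \<otimes>\<^bsub>A\<^esub> b (i - j)) else \<zero>\<^bsub>A\<^esub>)" for a b
    by (simp add: T)
  have addd: "a \<oplus>\<^bsub>?T\<^esub> b = (\<lambda>i. a i \<oplus>\<^bsub>A\<^esub> b i)" for a b
    by (simp add: T)
  have smu: "c \<odot>\<^bsub>?T\<^esub> a = (\<lambda>i. c \<odot>\<^bsub>A\<^esub> a i)" for c a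
    by (simp add: T)
  have mulc: "a \<otimes>\<^bsub>?T\<^esub> b \<in> carrier ?T" if "a \<in> carrier ?T" "b \<in> carrier ?T" for a b
    using conv[OF that] by (auto simp: T)
  have addc: "a \<oplus>\<^bsub>?T\<^esub> b \<in> carrier ?T" if "a \<in> carrier ?T" "b \<in> carrier ?T" for a b
    using that by (auto simp: T)
  have smuc: "c \<odot>\<^bsub>?T\<^esub> a \<in> carrier ?T" if "c \<in> carrier K" "a \<in> carrier ?T" for c a
    using that by (auto simp: T)
  have ab: "abelian_group ?T"
  proof (rule abelian_groupI)
    fix a assume a: "a \<in> carrier ?T"
    have "(\<lambda>i. \<ominus>\<^bsub>A\<^esub> a i) \<in> carrier ?T" "(\<lambda>i. \<ominus>\<^bsub>A\<^esub> a i) \<oplus>\<^bsub>?T\<^esub> a = \<zero>\<^bsub>?T\<^esub>"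
      using a carr[OF a] by (auto simp: T A.l_neg)
    then show "\<exists>b\<in>carrier ?T. b \<oplus>\<^bsub>?T\<^esub> a = \<zero>\<^bsub>?T\<^esub>" by blast
  next
    show "\<zero>\<^bsub>?T\<^esub> \<in> carrier ?T" by (auto simp: T)
  next
    fix a assume "a \<in> carrier ?T"
    then show "\<zero>\<^bsub>?T\<^esub> \<oplus>\<^bsub>?T\<^esub> a = a" using carr by (auto simp: T)
  qed (simp_all add: addc, auto simp: addd carr A.a_ac)
  have comm: "a \<otimes>\<^bsub>?T\<^esub> b = b \<otimes>\<^bsub>?T\<^esub> a" if "a \<in> carrier ?T" "b \<in> carrier ?T" for a b
    unfolding mul using that by (auto simp: carr A.convolution_comm)
  have assoc: "(a \<otimes>\<^bsub>?T\<^esub> b) \<otimes>\<^bsub>?T\<^esub> c = a \<otimes>\<^bsub>?T\<^esub> (b \<otimes>\<^bsub>?T\<^esub> c)"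
    if abc: "a \<in> carrier ?T" "b \<in> carrier ?T" "c \<in> carrier ?T" for a b c
  proof
    fix i
    show "((a \<otimes>\<^bsub>?T\<^esub> b) \<otimes>\<^bsub>?T\<^esub> c) i = (a \<otimes>\<^bsub>?T\<^esub> (b \<otimes>\<^bsub>?T\<^esub> c)) i"
    proof (cases "enat i \<le> m")
      case True
      have "((a \<otimes>\<^bsub>?T\<^esub> b) \<otimes>\<^bsub>?T\<^esub> c) i
          = (\<Oplus>\<^bsub>A\<^esub>j\<in>{..i}. (\<Oplus>\<^bsub>A\<^esub>l\<in>{..j}. a l \<otimes>\<^bsub>A\<^esub> b (j - l)) \<otimes>\<^bsub>A\<^esub> c (i - j))"
        unfolding mul using True down abc
        by (auto intro!: A.finsum_cong' simp: conv carr)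
      also have "\<dots> = (\<Oplus>\<^bsub>A\<^esub>j\<in>{..i}. a j \<otimes>\<^bsub>A\<^esub> (\<Oplus>\<^bsub>A\<^esub>l\<in>{..i - j}. b l \<otimes>\<^bsub>A\<^esub> c (i - j - l)))"
        using abc by (intro A.truncated_convolution_assoc) (auto simp: carr)
      also have "\<dots> = (a \<otimes>\<^bsub>?T\<^esub> (b \<otimes>\<^bsub>?T\<^esub> c)) i"
        unfolding mul using True down[OF True] abc
        by (auto intro!: A.finsum_cong' simp: conv carr)
      finally show ?thesis .
    qed (simp add: mul)
  qed
  have onec: "\<one>\<^bsub>?T\<^esub> \<in> carrier ?T" by (auto simp: T zero_enat_def[symmetric])
  have one: "\<one>\<^bsub>?T\<^esub> \<otimes>\<^bsub>?T\<^esub> a = a" if a: "a \<in> carrier ?T" for a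
  proof
    fix i
    show "(\<one>\<^bsub>?T\<^esub> \<otimes>\<^bsub>?T\<^esub> a) i = a i"
    proof (cases "enat i \<le> m")
      case True
      have "(\<one>\<^bsub>?T\<^esub> \<otimes>\<^bsub>?T\<^esub> a) i = (\<Oplus>\<^bsub>A\<^esub>j\<in>{..i}. if 0 = j then a (i - j) else \<zero>\<^bsub>A\<^esub>)"
        unfolding mul using True carr[OF a]
        by (auto intro!: A.finsum_cong' simp: T)
      also have "\<dots> = a i"
        using A.finsum_singleton[of 0 "{..i}" "\<lambda>j. a (i - j)"] carr[OF a] by auto
      finally show ?thesis .
    qed (simp add: mul zero[OF a])
  qed
  have distr: "(a \<oplus>\<^bsub>?T\<^esub> b) \<otimes>\<^bsub>?T\<^esub> c = a \<otimes>\<^bsub>?T\<^esub> c \<oplus>\<^bsub>?T\<^esub> b \<otimes>\<^bsub>?T\<^esub> c"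
    if abc: "a \<in> carrier ?T" "b \<in> carrier ?T" "c \<in> carrier ?T" for a b c
  proof
    fix i
    have "(\<Oplus>\<^bsub>A\<^esub>j\<in>{..i}. (a j \<oplus>\<^bsub>A\<^esub> b j) \<otimes>\<^bsub>A\<^esub> c (i - j))
        = (\<Oplus>\<^bsub>A\<^esub>j\<in>{..i}. a j \<otimes>\<^bsub>A\<^esub> c (i - j) \<oplus>\<^bsub>A\<^esub> b j \<otimes>\<^bsub>A\<^esub> c (i - j))"
      using abc by (intro A.finsum_cong') (auto simp: carr A.l_distr)
    also have "\<dots> = (\<Oplus>\<^bsub>A\<^esub>j\<in>{..i}. a j \<otimes>\<^bsub>A\<^esub> c (i - j)) \<oplus>\<^bsub>A\<^esub> (\<Oplus>\<^bsub>A\<^esub>j\<in>{..i}. b j \<otimes>\<^bsub>A\<^esub> c (i - j))"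
      using abc by (intro A.finsum_addf) (auto simp: carr)
    finally show "((a \<oplus>\<^bsub>?T\<^esub> b) \<otimes>\<^bsub>?T\<^esub> c) i = (a \<otimes>\<^bsub>?T\<^esub> c \<oplus>\<^bsub>?T\<^esub> b \<otimes>\<^bsub>?T\<^esub> c) i"
      by (simp add: mul addd)
  qed
  have cr: "cring ?T"
    by (rule cringI[OF ab comm_monoidI]; rule mulc onec assoc one distr comm; assumption)
  show ?thesis
  proof (rule algebraI[OF R_cring cr])
    fix c a b assume cab: "c \<in> carrier K" "a \<in> carrier ?T" "b \<in> carrier ?T"
    show "(c \<odot>\<^bsub>?T\<^esub> a) \<otimes>\<^bsub>?T\<^esub> b = c \<odot>\<^bsub>?T\<^esub> (a \<otimes>\<^bsub>?T\<^esub> b)"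
    proof
      fix i
      have gen: "(\<Oplus>\<^bsub>A\<^esub>j\<in>{..k}. (c \<odot>\<^bsub>A\<^esub> a j) \<otimes>\<^bsub>A\<^esub> b (i - j))
          = c \<odot>\<^bsub>A\<^esub> (\<Oplus>\<^bsub>A\<^esub>j\<in>{..k}. a j \<otimes>\<^bsub>A\<^esub> b (i - j))" for k
      proof (induction k)
        case 0
        then show ?case using cab by (simp add: carr smult_assoc2)
      next
        case (Suc k)
        have "(\<Oplus>\<^bsub>A\<^esub>j\<in>{..k}. a j \<otimes>\<^bsub>A\<^esub> b (i - j)) \<in> carrier A"
          using cab by (intro A.finsum_closed) (auto simp: carr)
        then show ?case
          using cab Suc by (simp add: carr smult_assoc2 smult_r_distr Pi_def)
      qed
      show "((c \<odot>\<^bsub>?T\<^esub> a) \<otimes>\<^bsub>?T\<^esub> b) i = (c \<odot>\<^bsub>?T\<^esub> (a \<otimes>\<^bsub>?T\<^esub> b)) i"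
        using cab by (simp add: mul smu gen)
    qed
  qed (simp_all add: smuc, auto simp: smu addd carr smult_l_distr smult_r_distr smult_assoc1)
qed

lemma jet_sum_terms:
  "(\<And>j. j \<le> n \<Longrightarrow> g j \<in> jet_terms K R m) \<Longrightarrow> jet_sum g n \<in> jet_terms K R m"
  by (induction n) (auto intro: jet_terms.add)

lemma jet_rel_terms:
  assumes "algebra K R" and "jet_rel K R m s t"
  shows "s \<in> jet_terms K R m \<and> t \<in> jet_terms K R m"
proof -
  interpret algebra K R by (rule assms)
  have down: "enat j \<le> m" if "enat i \<le> m" "j \<le> i" for i j
    using that by (meson enat_ord_simps(1) order_trans)
  have sum: "jet_sum (\<lambda>j. JMul (JD j f) (JD (i - j) g)) i \<in> jet_terms K R m"
    if "enat i \<le> m" "f \<in> carrier R" "g \<in> carrier R" for i f g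
    using that down[OF that(1)] by (intro jet_sum_terms jet_terms.mul jet_terms.gen) auto
  show ?thesis
    using assms(2) by induction (auto intro: jet_terms.intros simp: sum)
qed

primrec jet_eval ::
  "('k, 'b, 'r) module_scheme \<Rightarrow> ('a \<Rightarrow> nat \<Rightarrow> 'b) \<Rightarrow> ('k, 'a) jet_term \<Rightarrow> 'b" where
  "jet_eval A \<phi> (JScalar c) = c \<odot>\<^bsub>A\<^esub> \<one>\<^bsub>A\<^esub>"
| "jet_eval A \<phi> (JD i f) = \<phi> f i"
| "jet_eval A \<phi> (JAdd s t) = jet_eval A \<phi> s \<oplus>\<^bsub>A\<^esub> jet_eval A \<phi> t"
| "jet_eval A \<phi> (JMul s t) = jet_eval A \<phi> s \<otimes>\<^bsub>A\<^esub> jet_eval A \<phi> t"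
| "jet_eval A \<phi> (JNeg t) = \<ominus>\<^bsub>A\<^esub> jet_eval A \<phi> t"

context
  fixes K :: "('k, 'p) ring_scheme" and R :: "('k, 'a, 'q) module_scheme" and m :: enat
  assumes alg: "algebra K R"
begin

interpretation algebra K R by (rule alg)

private abbreviation "cls \<equiv> jet_class K R m"
private abbreviation "T \<equiv> jet_terms K R m"
private abbreviation "J \<equiv> jet_algebra K R m"

lemma jet_class_eq:
  assumes "s \<in> jet_terms K R m"
  shows "jet_class K R m s = jet_class K R m t \<longleftrightarrow> jet_rel K R m s t"
proof
  assume eq: "cls s = cls t"
  have "s \<in> cls s" using assms by (simp add: jet_class_def jet_rel.refl)
  then have "jet_rel K R m t s" unfolding eq by (simp add: jet_class_def)
  then show "jet_rel K R m s t" by (rule jet_rel.sym)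
next
  assume st: "jet_rel K R m s t"
  show "cls s = cls t"
    unfolding jet_class_def
    using jet_rel.trans[OF st] jet_rel.trans[OF jet_rel.sym[OF st]] by (intro Collect_cong iffI)
qed

lemma jet_class_eqI: "jet_rel K R m s t \<Longrightarrow> jet_class K R m s = jet_class K R m t"
  by (rule jet_class_eq[THEN iffD2, OF jet_rel_terms[OF alg, THEN conjunct1]])

lemma jet_carrier: "carrier (jet_algebra K R m) = jet_class K R m ` jet_terms K R m"
  by (simp add: jet_algebra_def)

lemma jet_class_carrier: "t \<in> jet_terms K R m \<Longrightarrow> jet_class K R m t \<in> carrier (jet_algebra K R m)"
  by (simp add: jet_carrier)

private lemma UN_const_eq:
  assumes "x \<in> P" and "\<And>x'. x' \<in> P \<Longrightarrow> F x' = C"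
  shows "(\<Union>x\<in>P. F x) = C"
  using assms by blast

private lemma UN2_const_eq:
  assumes "x \<in> P" and "y \<in> Q" and "\<And>x' y'. x' \<in> P \<Longrightarrow> y' \<in> Q \<Longrightarrow> F x' y' = C"
  shows "(\<Union>x\<in>P. \<Union>y\<in>Q. F x y) = C"
  using assms by blast

lemma jet_class_add:
  assumes "s \<in> jet_terms K R m" "t \<in> jet_terms K R m"
  shows "jet_class K R m s \<oplus>\<^bsub>jet_algebra K R m\<^esub> jet_class K R m t = jet_class K R m (JAdd s t)"
proof -
  have "(\<Union>s'\<in>cls s. \<Union>t'\<in>cls t. cls (JAdd s' t')) = cls (JAdd s t)"
  proof (rule UN2_const_eq)
    show "s \<in> cls s" "t \<in> cls t"
      using assms by (simp_all add: jet_class_def jet_rel.refl)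
    fix s' t' assume "s' \<in> cls s" "t' \<in> cls t"
    then show "cls (JAdd s' t') = cls (JAdd s t)"
      by (intro jet_class_eqI jet_rel.sym[OF jet_rel.add_cong]) (simp_all add: jet_class_def)
  qed
  then show ?thesis by (simp add: jet_algebra_def)
qed

lemma jet_class_mul:
  assumes "s \<in> jet_terms K R m" "t \<in> jet_terms K R m"
  shows "jet_class K R m s \<otimes>\<^bsub>jet_algebra K R m\<^esub> jet_class K R m t = jet_class K R m (JMul s t)"
proof -
  have "(\<Union>s'\<in>cls s. \<Union>t'\<in>cls t. cls (JMul s' t')) = cls (JMul s t)"
  proof (rule UN2_const_eq)
    show "s \<in> cls s" "t \<in> cls t"
      using assms by (simp_all add: jet_class_def jet_rel.refl)
    fix s' t' assume "s' \<in> cls s" "t' \<in> cls t"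
    then show "cls (JMul s' t') = cls (JMul s t)"
      by (intro jet_class_eqI jet_rel.sym[OF jet_rel.mul_cong]) (simp_all add: jet_class_def)
  qed
  then show ?thesis by (simp add: jet_algebra_def)
qed

lemma jet_class_smult:
  assumes "c \<in> carrier K" "t \<in> jet_terms K R m"
  shows "c \<odot>\<^bsub>jet_algebra K R m\<^esub> jet_class K R m t = jet_class K R m (JMul (JScalar c) t)"
proof -
  have "(\<Union>t'\<in>cls t. cls (JMul (JScalar c) t')) = cls (JMul (JScalar c) t)"
  proof (rule UN_const_eq)
    show "t \<in> cls t"
      using assms by (simp add: jet_class_def jet_rel.refl)
    fix t' assume "t' \<in> cls t"
    then show "cls (JMul (JScalar c) t') = cls (JMul (JScalar c) t)"
      using assms
      by (intro jet_class_eqI jet_rel.sym[OF jet_rel.mul_cong])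
        (simp_all add: jet_class_def jet_rel.refl jet_terms.scalar)
  qed
  then show ?thesis by (simp add: jet_algebra_def)
qed

lemma jet_zero: "\<zero>\<^bsub>jet_algebra K R m\<^esub> = jet_class K R m (JScalar \<zero>\<^bsub>K\<^esub>)"
  and jet_one: "\<one>\<^bsub>jet_algebra K R m\<^esub> = jet_class K R m (JScalar \<one>\<^bsub>K\<^esub>)"
  by (simp_all add: jet_algebra_def)

lemma jet_cring: "cring (jet_algebra K R m)"
proof -
  have z: "JScalar \<zero>\<^bsub>K\<^esub> \<in> T" and o: "JScalar \<one>\<^bsub>K\<^esub> \<in> T"
    by (simp_all add: jet_terms.scalar)
  note ops = jet_class_add jet_class_mul jet_zero jet_one jet_terms.add jet_terms.mul z o
  have ab: "abelian_group J"
  proof (rule abelian_groupI)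
    fix x assume "x \<in> carrier J"
    then obtain t where t: "t \<in> T" "x = cls t" by (auto simp: jet_carrier)
    then have "cls (JNeg t) \<oplus>\<^bsub>J\<^esub> x = \<zero>\<^bsub>J\<^esub>" "cls (JNeg t) \<in> carrier J"
      by (simp_all add: ops jet_terms.neg jet_class_carrier jet_class_eqI[OF jet_rel.l_neg])
    then show "\<exists>y\<in>carrier J. y \<oplus>\<^bsub>J\<^esub> x = \<zero>\<^bsub>J\<^esub>" by blast
  qed (unfold jet_carrier; (elim imageE)?; simp add: ops imageI;
      rule jet_class_eqI; rule jet_rel.a_assoc jet_rel.l_zero jet_rel.a_comm; assumption)+
  show ?thesis
    by (rule cringI[OF ab comm_monoidI]; unfold jet_carrier; (elim imageE)?; simp add: ops imageI;
      rule jet_class_eqI; rule jet_rel.m_assoc jet_rel.l_one jet_rel.l_distr jet_rel.m_comm; assumption)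
qed

theorem jet_algebra_algebra: "algebra K (jet_algebra K R m)"
proof -
  interpret J: cring "jet_algebra K R m" by (rule jet_cring)
  define e where "e c = cls (JScalar c)" for c
  have e: "e c \<in> carrier J" if "c \<in> carrier K" for c
    using that by (simp add: e_def jet_class_carrier jet_terms.scalar)
  have sm: "c \<odot>\<^bsub>J\<^esub> x = e c \<otimes>\<^bsub>J\<^esub> x" if "c \<in> carrier K" "x \<in> carrier J" for c x
    using that by (auto simp: e_def jet_carrier jet_class_smult jet_class_mul jet_terms.scalar)
  have ea: "e (c \<oplus>\<^bsub>K\<^esub> d) = e c \<oplus>\<^bsub>J\<^esub> e d" if "c \<in> carrier K" "d \<in> carrier K" for c d
    using that by (simp add: e_def jet_class_add jet_terms.scalar jet_class_eqI[OF jet_rel.scalar_add])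
  have em: "e (c \<otimes>\<^bsub>K\<^esub> d) = e c \<otimes>\<^bsub>J\<^esub> e d" if "c \<in> carrier K" "d \<in> carrier K" for c d
    using that by (simp add: e_def jet_class_mul jet_terms.scalar jet_class_eqI[OF jet_rel.scalar_mul])
  have e1: "e \<one>\<^bsub>K\<^esub> = \<one>\<^bsub>J\<^esub>" by (simp add: e_def jet_one)
  show ?thesis
    by (rule algebraI[OF R_cring jet_cring])
      (simp_all add: sm e ea em e1 J.l_distr J.r_distr J.m_assoc)
qed

lemma jet_D_carrier:
  "enat i \<le> m \<Longrightarrow> f \<in> carrier R \<Longrightarrow> jet_D K R m i f \<in> carrier (jet_algebra K R m)"
  by (simp add: jet_D_def jet_class_carrier jet_terms.gen)

lemma jet_class_sum:
  assumes "\<And>j. j \<le> n \<Longrightarrow> g j \<in> jet_terms K R m"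
  shows "jet_class K R m (jet_sum g n)
    = (\<Oplus>\<^bsub>jet_algebra K R m\<^esub>j\<in>{..n}. jet_class K R m (g j))"
proof -
  interpret J: cring "jet_algebra K R m" by (rule jet_cring)
  show ?thesis
    using assms
  proof (induction n)
    case 0
    then show ?case by (simp add: jet_class_carrier)
  next
    case (Suc n)
    have s: "jet_sum g n \<in> T" using Suc.prems by (intro jet_sum_terms) auto
    have "(\<Oplus>\<^bsub>J\<^esub>j\<in>{..Suc n}. cls (g j)) = cls (g (Suc n)) \<oplus>\<^bsub>J\<^esub> (\<Oplus>\<^bsub>J\<^esub>j\<in>{..n}. cls (g j))"
      using Suc.prems by (intro J.finsum_Suc) (auto simp: jet_class_carrier)
    also have "\<dots> = cls (g (Suc n)) \<oplus>\<^bsub>J\<^esub> cls (jet_sum g n)"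
      using Suc by simp
    also have "\<dots> = cls (jet_sum g n) \<oplus>\<^bsub>J\<^esub> cls (g (Suc n))"
      using Suc.prems s by (intro J.a_comm) (auto simp: jet_class_carrier)
    finally show ?case using Suc.prems s by (simp add: jet_class_add)
  qed
qed

theorem universal_jet_hom:
  "universal_jet K R m \<in> algebra_hom K R (truncated_series m (jet_algebra K R m))"
proof -
  interpret J: cring "jet_algebra K R m" by (rule jet_cring)
  interpret Ja: algebra K "jet_algebra K R m" by (rule jet_algebra_algebra)
  have down: "enat j \<le> m" if "enat i \<le> m" "j \<le> i" for i j
    using that by (meson enat_ord_simps(1) order_trans)
  have z: "enat 0 \<le> m" by (simp add: zero_enat_def[symmetric])
  have mul: "cls (JD i (f \<otimes>\<^bsub>R\<^esub> g)) = (\<Oplus>\<^bsub>J\<^esub>j\<in>{..i}. cls (JD j f) \<otimes>\<^bsub>J\<^esub> cls (JD (i - j) g))"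
    if "enat i \<le> m" "f \<in> carrier R" "g \<in> carrier R" for i f g
  proof -
    have dn: "j \<le> i \<Longrightarrow> JD j f \<in> T \<and> JD (i - j) g \<in> T" for j
      using that down[OF that(1)] by (auto intro!: jet_terms.gen)
    have "cls (JD i (f \<otimes>\<^bsub>R\<^esub> g)) = cls (jet_sum (\<lambda>j. JMul (JD j f) (JD (i - j) g)) i)"
      using that by (intro jet_class_eqI jet_rel.D_mult)
    also have "\<dots> = (\<Oplus>\<^bsub>J\<^esub>j\<in>{..i}. cls (JMul (JD j f) (JD (i - j) g)))"
      using dn by (intro jet_class_sum) (auto intro!: jet_terms.mul)
    also have "\<dots> = (\<Oplus>\<^bsub>J\<^esub>j\<in>{..i}. cls (JD j f) \<otimes>\<^bsub>J\<^esub> cls (JD (i - j) g))"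
      using dn by (intro J.finsum_cong') (auto simp: jet_class_mul jet_class_carrier)
    finally show ?thesis .
  qed
  show ?thesis
    unfolding algebra_hom_def ring_hom_def mem_Collect_eq
  proof (intro conjI allI impI ballI)
    show "universal_jet K R m \<in> carrier R \<rightarrow> carrier (truncated_series m J)"
      by (auto simp: universal_jet_def truncated_series_def jet_D_carrier)
  next
    fix f g assume fg: "f \<in> carrier R \<and> g \<in> carrier R"
    show "universal_jet K R m (f \<otimes>\<^bsub>R\<^esub> g)
        = universal_jet K R m f \<otimes>\<^bsub>truncated_series m J\<^esub> universal_jet K R m g"
    proof
      fix i
      show "universal_jet K R m (f \<otimes>\<^bsub>R\<^esub> g) i
        = (universal_jet K R m f \<otimes>\<^bsub>truncated_series m J\<^esub> universal_jet K R m g) i"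
      proof (cases "enat i \<le> m")
        case True
        then have "(universal_jet K R m f \<otimes>\<^bsub>truncated_series m J\<^esub> universal_jet K R m g) i
          = (\<Oplus>\<^bsub>J\<^esub>j\<in>{..i}. cls (JD j f) \<otimes>\<^bsub>J\<^esub> cls (JD (i - j) g))"
          using fg down[OF True]
          by (simp add: truncated_series_def, intro J.finsum_cong')
            (auto simp: universal_jet_def jet_D_def jet_class_carrier jet_terms.gen)
        with mul[OF True] fg True show ?thesis
          by (simp add: universal_jet_def jet_D_def)
      qed (simp add: universal_jet_def truncated_series_def)
    qed
    show "universal_jet K R m (f \<oplus>\<^bsub>R\<^esub> g)
        = universal_jet K R m f \<oplus>\<^bsub>truncated_series m J\<^esub> universal_jet K R m g"
      using fg by (auto simp: universal_jet_def truncated_series_def jet_D_def jet_class_add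
          jet_terms.gen fun_eq_iff jet_class_eqI[OF jet_rel.D_add])
  next
    show "universal_jet K R m \<one>\<^bsub>R\<^esub> = \<one>\<^bsub>truncated_series m J\<^esub>"
      using jet_class_eqI[OF jet_rel.D_one] z
      by (auto simp: universal_jet_def truncated_series_def jet_D_def fun_eq_iff jet_zero jet_one)
  next
    fix c f assume "c \<in> carrier K" "f \<in> carrier R"
    then show "universal_jet K R m (c \<odot>\<^bsub>R\<^esub> f)
        = c \<odot>\<^bsub>truncated_series m J\<^esub> universal_jet K R m f"
      by (auto simp: universal_jet_def truncated_series_def jet_D_def jet_class_smult
          jet_terms.gen fun_eq_iff jet_class_eqI[OF jet_rel.D_smult])
  qed
qed

theorem jet_algebra_represents:
  fixes A :: "('k, 'b, 'r) module_scheme"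
  assumes A: "algebra K A"
    and \<phi>: "\<phi> \<in> algebra_hom K R (truncated_series m A)"
  shows "\<exists>!\<psi>. \<psi> \<in> algebra_hom K (jet_algebra K R m) A \<inter> extensional (carrier (jet_algebra K R m)) \<and>
    (\<forall>f\<in>carrier R. \<forall>i. enat i \<le> m \<longrightarrow> \<psi> (jet_D K R m i f) = \<phi> f i)"
proof -
  interpret A: cring A by (rule algebra.M_cring[OF A])
  interpret Aa: algebra K A by (rule A)
  interpret J: cring "jet_algebra K R m" by (rule jet_cring)
  interpret Ja: algebra K "jet_algebra K R m" by (rule jet_algebra_algebra)
  let ?ev = "jet_eval A \<phi>"
  have down: "enat j \<le> m" if "enat i \<le> m" "j \<le> i" for i j
    using that by (meson enat_ord_simps(1) order_trans)
  have \<phi>c: "\<phi> f i \<in> carrier A" if "f \<in> carrier R" "enat i \<le> m" for f i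
    using \<phi> that unfolding algebra_hom_def ring_hom_def truncated_series_def Pi_def by auto
  have \<phi>m: "\<phi> (f \<otimes>\<^bsub>R\<^esub> g) i = (\<Oplus>\<^bsub>A\<^esub>j\<in>{..i}. \<phi> f j \<otimes>\<^bsub>A\<^esub> \<phi> g (i - j))"
    if "f \<in> carrier R" "g \<in> carrier R" "enat i \<le> m" for f g i
    using \<phi> that by (auto simp: algebra_hom_def ring_hom_def truncated_series_def)
  have \<phi>a: "\<phi> (f \<oplus>\<^bsub>R\<^esub> g) i = \<phi> f i \<oplus>\<^bsub>A\<^esub> \<phi> g i" if "f \<in> carrier R" "g \<in> carrier R" for f g i
    using \<phi> that by (auto simp: algebra_hom_def ring_hom_def truncated_series_def)
  have \<phi>s: "\<phi> (c \<odot>\<^bsub>R\<^esub> f) i = c \<odot>\<^bsub>A\<^esub> \<phi> f i" if "f \<in> carrier R" "c \<in> carrier K" for f c i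
    using \<phi> that by (auto simp: algebra_hom_def ring_hom_def truncated_series_def)
  have \<phi>1: "\<phi> \<one>\<^bsub>R\<^esub> i = (if i = 0 then \<one>\<^bsub>A\<^esub> else \<zero>\<^bsub>A\<^esub>)" for i
    using \<phi> by (auto simp: algebra_hom_def ring_hom_def truncated_series_def)
  have evc: "?ev t \<in> carrier A" if "t \<in> T" for t
    using that by induction (auto simp: \<phi>c)
  have sc: "(c \<odot>\<^bsub>A\<^esub> \<one>\<^bsub>A\<^esub>) \<otimes>\<^bsub>A\<^esub> x = c \<odot>\<^bsub>A\<^esub> x" if "c \<in> carrier K" "x \<in> carrier A" for c x
    using that by (simp add: Aa.smult_assoc2)
  have evs: "?ev (jet_sum g n) = (\<Oplus>\<^bsub>A\<^esub>j\<in>{..n}. ?ev (g j))"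
    if "\<And>j. j \<le> n \<Longrightarrow> g j \<in> T" for g and n :: nat
    using that
  proof (induction n)
    case 0
    then show ?case by (simp add: evc)
  next
    case (Suc n)
    have "(\<Oplus>\<^bsub>A\<^esub>j\<in>{..n}. ?ev (g j)) \<in> carrier A"
      using Suc.prems by (intro A.finsum_closed) (auto simp: evc)
    moreover have "?ev (g (Suc n)) \<in> carrier A" using Suc.prems by (simp add: evc)
    moreover have "(\<Oplus>\<^bsub>A\<^esub>j\<in>{..Suc n}. ?ev (g j)) = ?ev (g (Suc n)) \<oplus>\<^bsub>A\<^esub> (\<Oplus>\<^bsub>A\<^esub>j\<in>{..n}. ?ev (g j))"
      using Suc.prems by (intro A.finsum_Suc) (auto simp: evc)
    ultimately show ?case using Suc by (simp add: A.a_comm)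
  qed
  have evr: "?ev s = ?ev t" if "jet_rel K R m s t" for s t
    using that
  proof induction
    case (D_mult i f g)
    then have "?ev (jet_sum (\<lambda>j. JMul (JD j f) (JD (i - j) g)) i)
        = (\<Oplus>\<^bsub>A\<^esub>j\<in>{..i}. ?ev (JMul (JD j f) (JD (i - j) g)))"
      using down[OF D_mult(1)] by (intro evs) (auto intro!: jet_terms.intros)
    then show ?case using D_mult \<phi>m by simp
  next
    case (scalar_mul c d)
    then show ?case by (simp add: sc Aa.smult_assoc1)
  next
    case (a_comm s t)
    then show ?case by (simp add: evc A.a_comm)
  next
    case (m_comm s t)
    then show ?case by (simp add: evc A.m_comm)
  qed (auto simp: evc \<phi>c \<phi>a \<phi>s \<phi>1 sc A.a_assoc A.m_assoc A.l_neg A.l_distr Aa.smult_l_distr)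
  define \<psi> where "\<psi> = restrict (\<lambda>P. ?ev (SOME t. t \<in> P)) (carrier J)"
  have \<psi>: "\<psi> (cls t) = ?ev t" if "t \<in> T" for t
  proof -
    have "t \<in> cls t" using that by (simp add: jet_class_def jet_rel.refl)
    then have "(SOME u. u \<in> cls t) \<in> cls t" by (rule someI)
    then have "?ev t = ?ev (SOME u. u \<in> cls t)"
      by (intro evr) (simp add: jet_class_def)
    with that show ?thesis by (simp add: \<psi>_def jet_class_carrier)
  qed
  show ?thesis
  proof (rule ex1I[of _ \<psi>])
    have "\<psi> \<in> ring_hom J A"
      by (rule ring_hom_memI)
        (auto simp: jet_carrier \<psi> evc jet_class_mul jet_class_add jet_one
          jet_terms.intros)
    moreover have "\<psi> (c \<odot>\<^bsub>J\<^esub> x) = c \<odot>\<^bsub>A\<^esub> \<psi> x" if "c \<in> carrier K" "x \<in> carrier J" for c x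
      using that by (auto simp: jet_carrier jet_class_smult \<psi> sc evc jet_terms.intros)
    ultimately show "\<psi> \<in> algebra_hom K J A \<inter> extensional (carrier J) \<and>
        (\<forall>f\<in>carrier R. \<forall>i. enat i \<le> m \<longrightarrow> \<psi> (jet_D K R m i f) = \<phi> f i)"
      by (auto simp: algebra_hom_def \<psi>_def[THEN arg_cong[of _ _ "\<lambda>f. f \<in> extensional _"]]
          jet_D_def \<psi> jet_terms.gen)
  next
    fix \<chi> assume \<chi>: "\<chi> \<in> algebra_hom K J A \<inter> extensional (carrier J) \<and>
        (\<forall>f\<in>carrier R. \<forall>i. enat i \<le> m \<longrightarrow> \<chi> (jet_D K R m i f) = \<phi> f i)"
    then have hom: "\<chi> \<in> ring_hom J A" by (simp add: algebra_hom_def)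
    interpret h: ring_hom_cring J A \<chi>
      using hom by unfold_locales
    have "\<chi> (cls t) = ?ev t" if "t \<in> T" for t
      using that
    proof induction
      case (scalar c)
      then have "cls (JScalar c) = c \<odot>\<^bsub>J\<^esub> \<one>\<^bsub>J\<^esub>"
        by (auto simp: jet_one jet_class_smult jet_terms.scalar
            intro!: jet_class_eqI jet_rel.trans[OF jet_rel.sym[OF jet_rel.l_one] jet_rel.m_comm])
      then show ?case using \<chi> scalar by (simp add: algebra_hom_def)
    next
      case (gen i f)
      then show ?case using \<chi> by (simp add: jet_D_def)
    next
      case (add s t)
      then show ?case by (simp flip: jet_class_add add: jet_class_carrier)
    next
      case (mul s t)
      then show ?case by (simp flip: jet_class_mul add: jet_class_carrier)
    next
      case (neg t)
      have "cls (JNeg t) \<oplus>\<^bsub>J\<^esub> cls t = \<zero>\<^bsub>J\<^esub>"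
        using neg by (simp add: jet_class_add jet_zero jet_terms.neg jet_class_eqI[OF jet_rel.l_neg])
      then have "cls (JNeg t) = \<ominus>\<^bsub>J\<^esub> cls t"
        using neg by (intro J.minus_equality[symmetric]) (auto simp: jet_class_carrier jet_terms.neg)
      then show ?case using neg by (simp add: jet_class_carrier)
    qed
    then show "\<chi> = \<psi>"
      using \<chi> by (intro extensionalityI[of _ "carrier J"]) (auto simp: \<psi>_def[THEN arg_cong[of _ _ "\<lambda>f. f \<in> extensional _"]] jet_carrier \<psi>)
  qed
qed

end

end

theory Submission
  imports Defs
begin

text \<open>
  Give \<open>D\<^sub>i f\<close> weight \<open>i\<close>. In weights \<open>\<le> min l n\<close> the rings \<open>R\<^sub>l\<close> and \<open>R\<^sub>n\<close> have the same generators and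
  relations, so membership of \<open>D\<^sub>i f\<close> in the homogeneous ideal \<open>\<aa>\<^sub>n + \<mm>R\<^sub>n\<close> does not depend on \<open>n \<ge> i\<close>.
  No grading has to be constructed: by representability,
  \<open>f \<mapsto> \<Sum>\<^sub>i D\<^sub>i(f) s^i t^i\<close>, with \<open>i\<close> running up to \<open>min l n\<close>, corresponds to a homomorphism
  \<open>R\<^sub>l \<rightarrow> R\<^sub>n[s]/(s^(n+1))\<close> that sends \<open>D\<^sub>i f\<close> to \<open>D\<^sub>i(f) s^i\<close>, and the series with coefficients in
  \<open>\<aa>\<^sub>n + \<mm>R\<^sub>n\<close> form an ideal.
\<close>

section \<open>Truncated series\<close>

lemma truncated_series_coeff:
  "algebra K A \<Longrightarrow> a \<in> carrier (truncated_series n A) \<Longrightarrow> a i \<in> carrier A"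
  using cring.cring_simprules(2)[OF algebra.M_cring, of K A]
  by (auto simp: truncated_series_def split: if_splits)

lemma truncated_series_finsum:
  assumes A: "algebra K A"
    and F: "\<And>j. j \<le> k \<Longrightarrow> F j \<in> carrier (truncated_series n A)"
  shows "(\<Oplus>\<^bsub>truncated_series n A\<^esub>j\<in>{..k::nat}. F j) p = (\<Oplus>\<^bsub>A\<^esub>j\<in>{..k}. F j p)"
proof -
  interpret A: cring A by (rule algebra.M_cring[OF A])
  interpret T: cring "truncated_series n A"
    by (rule algebra.M_cring[OF truncated_series_algebra[OF A]])
  show ?thesis
    using F
  proof (induction k)
    case 0
    then show ?case by (simp add: truncated_series_coeff[OF A])
  next
    case (Suc k)
    then have "(\<Oplus>\<^bsub>truncated_series n A\<^esub>j\<in>{..Suc k}. F j)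
        = F (Suc k) \<oplus>\<^bsub>truncated_series n A\<^esub> (\<Oplus>\<^bsub>truncated_series n A\<^esub>j\<in>{..k}. F j)"
      by (intro T.finsum_Suc) auto
    moreover have "(\<Oplus>\<^bsub>A\<^esub>j\<in>{..Suc k}. F j p) = F (Suc k) p \<oplus>\<^bsub>A\<^esub> (\<Oplus>\<^bsub>A\<^esub>j\<in>{..k}. F j p)"
      using Suc.prems by (intro A.finsum_Suc) (auto intro: truncated_series_coeff[OF A])
    ultimately show ?case
      using Suc by (simp add: truncated_series_def)
  qed
qed

lemma truncated_series_ideal:
  assumes A: "algebra K A" and I: "ideal I A"
  shows "ideal {a \<in> carrier (truncated_series n A). \<forall>i. a i \<in> I} (truncated_series n A)"
    (is "ideal ?I ?T")
proof -
  interpret A: cring A by (rule algebra.M_cring[OF A])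
  interpret T: cring ?T by (rule algebra.M_cring[OF truncated_series_algebra[OF A]])
  interpret I: ideal I A by (rule I)
  have finsum: "(\<Oplus>\<^bsub>A\<^esub>j\<in>{..k}. F j) \<in> I" if "\<And>j. F j \<in> I" for F and k :: nat
    using that I.Icarr[OF that] by (induction k) (simp_all add: Pi_def)
  have neg: "\<ominus>\<^bsub>?T\<^esub> a = (\<lambda>i. \<ominus>\<^bsub>A\<^esub> a i)" if "a \<in> carrier ?T" for a
    using that truncated_series_coeff[OF A that]
    by (intro T.minus_equality) (auto simp: truncated_series_def A.l_neg)
  have mult: "x \<otimes>\<^bsub>?T\<^esub> a \<in> ?I" if "a \<in> ?I" "x \<in> carrier ?T" for a x
  proof -
    have "x \<otimes>\<^bsub>?T\<^esub> a \<in> carrier ?T" using that by simp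
    moreover have "(x \<otimes>\<^bsub>?T\<^esub> a) i \<in> I" for i
      using that truncated_series_coeff[OF A that(2)]
      by (simp add: truncated_series_def finsum I.I_l_closed)
    ultimately show ?thesis by blast
  qed
  show ?thesis
  proof (rule idealI[OF T.ring_axioms])
    show "subgroup ?I (add_monoid ?T)"
    proof (rule T.add.subgroupI)
      show "?I \<noteq> {}"
        using T.zero_closed by (auto simp: truncated_series_def intro!: exI[of _ "\<lambda>i. \<zero>\<^bsub>A\<^esub>"])
    next
      fix a assume a: "a \<in> ?I"
      then show "\<ominus>\<^bsub>?T\<^esub> a \<in> ?I"
        using T.a_inv_closed[of a] by (auto simp: neg)
    next
      fix a b assume ab: "a \<in> ?I" "b \<in> ?I"
      then have "a \<oplus>\<^bsub>?T\<^esub> b \<in> carrier ?T" by simp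
      with ab show "a \<oplus>\<^bsub>?T\<^esub> b \<in> ?I"
        by (simp add: truncated_series_def)
    qed auto
  next
    fix a x assume ax: "a \<in> ?I" "x \<in> carrier ?T"
    then show "x \<otimes>\<^bsub>?T\<^esub> a \<in> ?I" by (rule mult)
    with ax show "a \<otimes>\<^bsub>?T\<^esub> x \<in> ?I" by (metis (no_types, lifting) T.m_comm mem_Collect_eq)
  qed
qed

definition monomial :: "('b, 'r) ring_scheme \<Rightarrow> nat \<Rightarrow> 'b \<Rightarrow> nat \<Rightarrow> 'b"
  where "monomial A i a = (\<lambda>j. if j = i then a else \<zero>\<^bsub>A\<^esub>)"

lemma monomial_carrier:
  assumes "algebra K A" and "enat i \<le> n" and "a \<in> carrier A"
  shows "monomial A i a \<in> carrier (truncated_series n A)"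
proof -
  interpret A: cring A by (rule algebra.M_cring[OF assms(1)])
  show ?thesis using assms by (auto simp: monomial_def truncated_series_def)
qed

lemma monomial_zero_carrier:
  assumes "algebra K A"
  shows "monomial A i \<zero>\<^bsub>A\<^esub> \<in> carrier (truncated_series n A)"
proof -
  interpret A: cring A by (rule algebra.M_cring[OF assms])
  show ?thesis by (auto simp: monomial_def truncated_series_def)
qed

lemma monomial_mult:
  assumes A: "algebra K A" and a: "a \<in> carrier A" and b: "b \<in> carrier A"
  shows "monomial A i a \<otimes>\<^bsub>truncated_series n A\<^esub> monomial A j b
    = monomial A (i + j) (if enat (i + j) \<le> n then a \<otimes>\<^bsub>A\<^esub> b else \<zero>\<^bsub>A\<^esub>)"
proof
  interpret A: cring A by (rule algebra.M_cring[OF A])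
  fix p
  let ?S = "\<Oplus>\<^bsub>A\<^esub>q\<in>{..p}. monomial A i a q \<otimes>\<^bsub>A\<^esub> monomial A j b (p - q)"
  have "?S = (if p = i + j then a \<otimes>\<^bsub>A\<^esub> b else \<zero>\<^bsub>A\<^esub>)"
  proof (cases "p = i + j")
    case True
    then have "?S = (\<Oplus>\<^bsub>A\<^esub>q\<in>{..p}. if i = q then a \<otimes>\<^bsub>A\<^esub> b else \<zero>\<^bsub>A\<^esub>)"
      using a b by (intro A.finsum_cong') (auto simp: monomial_def)
    also have "\<dots> = a \<otimes>\<^bsub>A\<^esub> b"
      using True a b A.finsum_singleton[of i "{..p}" "\<lambda>_. a \<otimes>\<^bsub>A\<^esub> b"] by simp
    finally show ?thesis using True by simp
  next
    case False
    then have "?S = (\<Oplus>\<^bsub>A\<^esub>q\<in>{..p}. \<zero>\<^bsub>A\<^esub>)"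
      using a b by (intro A.finsum_cong') (auto simp: monomial_def)
    with False show ?thesis by simp
  qed
  then show "(monomial A i a \<otimes>\<^bsub>truncated_series n A\<^esub> monomial A j b) p
      = monomial A (i + j) (if enat (i + j) \<le> n then a \<otimes>\<^bsub>A\<^esub> b else \<zero>\<^bsub>A\<^esub>) p"
    by (auto simp: truncated_series_def monomial_def)
qed

text \<open>The substitution \<open>t \<mapsto> s t\<close>.\<close>
lemma algebra_hom_monomial:
  assumes A: "algebra K A" and R: "algebra K R"
    and h: "h \<in> algebra_hom K R (truncated_series n A)"
  shows "(\<lambda>f i. if enat i \<le> l then monomial A i (h f i) else \<zero>\<^bsub>truncated_series n A\<^esub>)
    \<in> algebra_hom K R (truncated_series l (truncated_series n A))"
    (is "?h \<in> algebra_hom K R (truncated_series l ?T)")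
proof -
  interpret A: cring A by (rule algebra.M_cring[OF A])
  interpret Aa: algebra K A by (rule A)
  interpret T: cring ?T by (rule algebra.M_cring[OF truncated_series_algebra[OF A]])
  have Ts: "\<zero>\<^bsub>?T\<^esub> = (\<lambda>i. \<zero>\<^bsub>A\<^esub>)" "a \<oplus>\<^bsub>?T\<^esub> b = (\<lambda>i. a i \<oplus>\<^bsub>A\<^esub> b i)"
    "c \<odot>\<^bsub>?T\<^esub> a = (\<lambda>i. c \<odot>\<^bsub>A\<^esub> a i)" for a b c
    by (simp_all add: truncated_series_def)
  have hT: "h f \<in> carrier ?T" if "f \<in> carrier R" for f
    using h that by (auto simp: algebra_hom_def ring_hom_def)
  have hc: "h f i \<in> carrier A" if "f \<in> carrier R" for f i
    using truncated_series_coeff[OF A hT[OF that]] .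
  have mc: "monomial A i (h f i) \<in> carrier ?T" if "f \<in> carrier R" for f i
  proof (cases "enat i \<le> n")
    case False
    then have "h f i = \<zero>\<^bsub>A\<^esub>"
      using hT[OF that] by (auto simp: truncated_series_def split: if_splits)
    then show ?thesis using monomial_zero_carrier[OF A] by simp
  qed (use that in \<open>simp add: monomial_carrier[OF A] hc\<close>)
  have mult: "monomial A i (h (f \<otimes>\<^bsub>R\<^esub> g) i)
      = (\<Oplus>\<^bsub>?T\<^esub>j\<in>{..i}. monomial A j (h f j) \<otimes>\<^bsub>?T\<^esub> monomial A (i - j) (h g (i - j)))"
    (is "_ = ?S") if fg: "f \<in> carrier R" "g \<in> carrier R" for f g i
  proof
    fix p
    let ?c = "\<lambda>j. if enat i \<le> n then h f j \<otimes>\<^bsub>A\<^esub> h g (i - j) else \<zero>\<^bsub>A\<^esub>"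
    have "?S p = (\<Oplus>\<^bsub>A\<^esub>j\<in>{..i}. (monomial A j (h f j) \<otimes>\<^bsub>?T\<^esub> monomial A (i - j) (h g (i - j))) p)"
      using fg by (intro truncated_series_finsum[OF A]) (simp add: mc)
    also have "\<dots> = (\<Oplus>\<^bsub>A\<^esub>j\<in>{..i}. monomial A i (?c j) p)"
      using fg by (intro A.finsum_cong') (auto simp: monomial_mult[OF A] hc, auto simp: monomial_def hc)
    also have "\<dots> = monomial A i (h (f \<otimes>\<^bsub>R\<^esub> g) i) p"
      using h fg by (auto simp: monomial_def algebra_hom_def ring_hom_def truncated_series_def)
    finally show "monomial A i (h (f \<otimes>\<^bsub>R\<^esub> g) i) p = ?S p" ..
  qed
  show ?thesis
    unfolding algebra_hom_def ring_hom_def mem_Collect_eq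
  proof (intro conjI allI impI ballI)
    show "?h \<in> carrier R \<rightarrow> carrier (truncated_series l ?T)"
      using mc by (auto simp: truncated_series_def[of l])
  next
    fix f g assume fg: "f \<in> carrier R \<and> g \<in> carrier R"
    show "?h (f \<otimes>\<^bsub>R\<^esub> g) = ?h f \<otimes>\<^bsub>truncated_series l ?T\<^esub> ?h g"
    proof
      fix i
      show "?h (f \<otimes>\<^bsub>R\<^esub> g) i = (?h f \<otimes>\<^bsub>truncated_series l ?T\<^esub> ?h g) i"
      proof (cases "enat i \<le> l")
        case True
        have "enat j \<le> l" if "j \<le> i" for j
          using that True by (meson enat_ord_simps(1) order_trans)
        with True fg have "(?h f \<otimes>\<^bsub>truncated_series l ?T\<^esub> ?h g) i
            = (\<Oplus>\<^bsub>?T\<^esub>j\<in>{..i}. monomial A j (h f j) \<otimes>\<^bsub>?T\<^esub> monomial A (i - j) (h g (i - j)))"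
          by (simp add: truncated_series_def[of l], intro T.finsum_cong') (auto simp: mc)
        with True fg show ?thesis by (simp add: mult)
      qed (simp add: truncated_series_def[of l])
    qed
    have "h (f \<oplus>\<^bsub>R\<^esub> g) = h f \<oplus>\<^bsub>?T\<^esub> h g"
      using h fg by (auto simp: algebra_hom_def ring_hom_def)
    then show "?h (f \<oplus>\<^bsub>R\<^esub> g) = ?h f \<oplus>\<^bsub>truncated_series l ?T\<^esub> ?h g"
      by (auto simp: truncated_series_def[of l] Ts monomial_def fun_eq_iff)
  next
    have "h \<one>\<^bsub>R\<^esub> = \<one>\<^bsub>?T\<^esub>"
      using h by (auto simp: algebra_hom_def ring_hom_def)
    then show "?h \<one>\<^bsub>R\<^esub> = \<one>\<^bsub>truncated_series l ?T\<^esub>"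
      by (auto simp: truncated_series_def monomial_def fun_eq_iff zero_enat_def[symmetric])
  next
    fix c f assume c: "c \<in> carrier K" and f: "f \<in> carrier R"
    then have "h (c \<odot>\<^bsub>R\<^esub> f) = c \<odot>\<^bsub>?T\<^esub> h f"
      using h by (auto simp: algebra_hom_def)
    then show "?h (c \<odot>\<^bsub>R\<^esub> f) = c \<odot>\<^bsub>truncated_series l ?T\<^esub> ?h f"
      using c by (auto simp: truncated_series_def[of l] Ts monomial_def fun_eq_iff)
  qed
qed

section \<open>The ideal cutting out a jet closure\<close>

definition jet_closure_ideal ::
    "('k, 'p) ring_scheme \<Rightarrow> ('k, 'a, 'q) module_scheme \<Rightarrow> enat \<Rightarrow>
      'a set \<Rightarrow> 'a set \<Rightarrow> ('k, 'a) jet_term set set"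
  where "jet_closure_ideal K R n I J =
    jet_ideal K R n I <+>\<^bsub>jet_algebra K R n\<^esub> jet_extension K R n J"

context
  fixes K :: "('k, 'p) ring_scheme" and R :: "('k, 'a, 'q) module_scheme" and n :: enat
    and I J :: "'a set"
  assumes R: "algebra K R" and I: "I \<subseteq> carrier R" and J: "J \<subseteq> carrier R"
begin

interpretation JA: cring "jet_algebra K R n" by (rule jet_cring[OF R])

lemma jet_ideal_ideal: "ideal (jet_ideal K R n I) (jet_algebra K R n)"
  unfolding jet_ideal_def using I by (intro JA.genideal_ideal) (auto simp: jet_D_carrier[OF R])

lemma jet_extension_ideal: "ideal (jet_extension K R n J) (jet_algebra K R n)"
  unfolding jet_extension_def using J
  by (intro JA.genideal_ideal) (auto simp: jet_D_carrier[OF R] zero_enat_def[symmetric])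

lemma jet_closure_ideal_ideal: "ideal (jet_closure_ideal K R n I J) (jet_algebra K R n)"
  unfolding jet_closure_ideal_def
  by (rule JA.add_ideals[OF jet_ideal_ideal jet_extension_ideal])

lemma jet_closure_ideal_least:
  assumes P: "ideal P (jet_algebra K R n)"
    and "\<And>f i. f \<in> I \<Longrightarrow> enat i \<le> n \<Longrightarrow> jet_D K R n i f \<in> P"
    and "\<And>f. f \<in> J \<Longrightarrow> jet_D K R n 0 f \<in> P"
  shows "jet_closure_ideal K R n I J \<subseteq> P"
proof -
  interpret P: ideal P "jet_algebra K R n" by (rule P)
  have "jet_ideal K R n I \<subseteq> P"
    unfolding jet_ideal_def by (rule JA.genideal_minimal[OF P]) (use assms in blast)
  moreover have "jet_extension K R n J \<subseteq> P"
    unfolding jet_extension_def by (rule JA.genideal_minimal[OF P]) (use assms in blast)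
  ultimately show ?thesis
    unfolding jet_closure_ideal_def set_add_def' by (blast intro: P.a_closed)
qed

lemma jet_D_in_jet_closure_ideal:
  assumes "f \<in> I" and "enat i \<le> n"
  shows "jet_D K R n i f \<in> jet_closure_ideal K R n I J"
proof -
  interpret E: ideal "jet_extension K R n J" "jet_algebra K R n" by (rule jet_extension_ideal)
  have "jet_D K R n i f \<in> jet_ideal K R n I"
    unfolding jet_ideal_def using assms I
    by (intro JA.genideal_self[THEN subsetD]) (auto simp: jet_D_carrier[OF R])
  moreover have "jet_D K R n i f \<in> carrier (jet_algebra K R n)"
    using assms I by (auto simp: jet_D_carrier[OF R])
  ultimately show ?thesis
    using JA.r_zero[symmetric] E.zero_closed
    unfolding jet_closure_ideal_def set_add_def' by blast
qed

lemma jet_D_0_in_jet_closure_ideal: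
  assumes "f \<in> J"
  shows "jet_D K R n 0 f \<in> jet_closure_ideal K R n I J"
proof -
  interpret E: ideal "jet_ideal K R n I" "jet_algebra K R n" by (rule jet_ideal_ideal)
  have c: "jet_D K R n 0 f \<in> carrier (jet_algebra K R n)"
    using assms J by (auto simp: jet_D_carrier[OF R] zero_enat_def[symmetric])
  have "jet_D K R n 0 f \<in> jet_extension K R n J"
    unfolding jet_extension_def using assms J
    by (intro JA.genideal_self[THEN subsetD])
      (auto simp: jet_D_carrier[OF R] zero_enat_def[symmetric])
  with c show ?thesis
    using JA.l_zero[symmetric] E.zero_closed
    unfolding jet_closure_ideal_def set_add_def' by blast
qed

end

lemma jet_D_mem_jet_closure_ideal_mono:
  fixes K :: "('k, 'p) ring_scheme" and R :: "('k, 'a, 'q) module_scheme"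
  assumes R: "algebra K R" and I: "I \<subseteq> carrier R" and J: "J \<subseteq> carrier R"
    and f: "f \<in> carrier R" and i: "enat i \<le> l" "enat i \<le> n"
    and mem: "jet_D K R l i f \<in> jet_closure_ideal K R l I J"
  shows "jet_D K R n i f \<in> jet_closure_ideal K R n I J"
proof -
  let ?A = "jet_algebra K R n" and ?L = "jet_algebra K R l"
  let ?T = "truncated_series n ?A"
  let ?S = "jet_closure_ideal K R n I J"
  have A: "algebra K ?A" by (rule jet_algebra_algebra[OF R])
  have T: "algebra K ?T" by (rule truncated_series_algebra[OF A])
  have S: "ideal ?S ?A" by (rule jet_closure_ideal_ideal[OF R I J])
  interpret S: ideal ?S ?A by (rule S)
  define \<phi> where "\<phi> =
    (\<lambda>f i. if enat i \<le> l then monomial ?A i (universal_jet K R n f i) else \<zero>\<^bsub>?T\<^esub>)"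
  have "\<phi> \<in> algebra_hom K R (truncated_series l ?T)"
    unfolding \<phi>_def by (rule algebra_hom_monomial[OF A R universal_jet_hom[OF R]])
  from jet_algebra_represents[OF R T this] obtain \<psi> where
    hom: "\<psi> \<in> algebra_hom K ?L ?T"
    and \<psi>: "\<And>f j. f \<in> carrier R \<Longrightarrow> enat j \<le> l \<Longrightarrow> \<psi> (jet_D K R l j f) = \<phi> f j"
    by blast
  interpret h: ring_hom_ring ?L ?T \<psi>
    using hom unfolding algebra_hom_def
    by (intro ring_hom_ringI2 cring.axioms(1) algebra.M_cring[OF T] jet_cring[OF R]) simp
  let ?I = "{a \<in> carrier ?T. \<forall>j. a j \<in> ?S}"
  have gen: "jet_D K R l j g \<in> {x \<in> carrier ?L. \<psi> x \<in> ?I}"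
    if g: "g \<in> carrier R" and j: "enat j \<le> l"
      and in_S: "enat j \<le> n \<Longrightarrow> jet_D K R n j g \<in> ?S" for g j
  proof -
    have c: "jet_D K R l j g \<in> carrier ?L" using g j by (simp add: jet_D_carrier[OF R])
    then have "\<psi> (jet_D K R l j g) \<in> carrier ?T" by simp
    moreover have "\<psi> (jet_D K R l j g) p \<in> ?S" for p
      using in_S S.zero_closed by (simp add: \<psi> g j \<phi>_def monomial_def universal_jet_def)
    ultimately show ?thesis using c by blast
  qed
  have "jet_closure_ideal K R l I J \<subseteq> {x \<in> carrier ?L. \<psi> x \<in> ?I}"
  proof (rule jet_closure_ideal_least[OF R I J])
    show "ideal {x \<in> carrier ?L. \<psi> x \<in> ?I} ?L"
      by (rule h.ideal_vimage[OF truncated_series_ideal[OF A S]])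
  next
    fix g j assume g: "g \<in> I" "enat j \<le> l"
    show "jet_D K R l j g \<in> {x \<in> carrier ?L. \<psi> x \<in> ?I}"
      using g I by (intro gen jet_D_in_jet_closure_ideal[OF R I J]) auto
  next
    fix g assume g: "g \<in> J"
    show "jet_D K R l 0 g \<in> {x \<in> carrier ?L. \<psi> x \<in> ?I}"
      using g J by (intro gen jet_D_0_in_jet_closure_ideal[OF R I J])
        (auto simp: zero_enat_def[symmetric])
  qed
  with mem have "\<psi> (jet_D K R l i f) i \<in> ?S" by blast
  then show ?thesis using f i by (simp add: \<psi> \<phi>_def monomial_def universal_jet_def)
qed

lemma mem_jet_closure_iff:
  assumes R: "algebra K R" and I: "I \<subseteq> carrier R" and J: "J \<subseteq> carrier R"
  shows "f \<in> jet_closure K R J n I \<longleftrightarrow> f \<in> carrier R \<and>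
    (\<forall>g\<in>PIdl\<^bsub>R\<^esub> f. \<forall>i. enat i \<le> n \<longrightarrow> jet_D K R n i g \<in> jet_closure_ideal K R n I J)"
proof (cases "f \<in> carrier R")
  case True
  interpret R: cring R by (rule algebra.M_cring[OF R])
  interpret JA: cring "jet_algebra K R n" by (rule jet_cring[OF R])
  let ?G = "{jet_D K R n i g | i g. g \<in> PIdl\<^bsub>R\<^esub> f \<and> enat i \<le> n}"
  have "PIdl\<^bsub>R\<^esub> f \<subseteq> carrier R" using True by (auto simp: cgenideal_def)
  then have "?G \<subseteq> carrier (jet_algebra K R n)"
    by (auto simp: jet_D_carrier[OF R])
  then have "jet_ideal K R n (PIdl\<^bsub>R\<^esub> f) \<subseteq> jet_closure_ideal K R n I J
      \<longleftrightarrow> ?G \<subseteq> jet_closure_ideal K R n I J"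
    unfolding jet_ideal_def
    using JA.Idl_subset_ideal[OF jet_closure_ideal_ideal[OF R I J]] by blast
  with True show ?thesis
    by (auto simp: jet_closure_def jet_closure_ideal_def)
qed (simp add: jet_closure_def)

theorem proposition3p12:
  fixes K :: "('k, 'p) ring_scheme" and R :: "('k, 'a, 'q) module_scheme"
    and \<mm> \<aa> :: "'a set"
  assumes "field K" and "algebra K R" and "local_ring R \<mm>" and "ideal \<aa> R"
  shows "(\<Inter>m::nat. jet_closure K R \<mm> (enat m) \<aa>) = arc_closure K R \<mm> \<aa>"
proof -
  note R = \<open>algebra K R\<close>
  interpret R: cring R by (rule algebra.M_cring[OF R])
  have a: "\<aa> \<subseteq> carrier R"
    using ideal.Icarr[OF assms(4)] by blast
  have "ideal \<mm> R"
    using assms(3) by (auto simp: local_ring_def intro: maximalideal.axioms(1))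
  then have m: "\<mm> \<subseteq> carrier R"
    using ideal.Icarr[of \<mm>] by blast
  note iff = mem_jet_closure_iff[OF R a m]
  have car: "g \<in> carrier R" if "f \<in> carrier R" "g \<in> PIdl\<^bsub>R\<^esub> f" for f g
    using that by (auto simp: cgenideal_def)
  note mono = jet_D_mem_jet_closure_ideal_mono[OF R a m]
  show ?thesis
  proof (intro subset_antisym subsetI)
    fix f assume "f \<in> (\<Inter>m::nat. jet_closure K R \<mm> (enat m) \<aa>)"
    then have f: "f \<in> jet_closure K R \<mm> (enat i) \<aa>" for i by blast
    then have fR: "f \<in> carrier R" by (simp add: iff)
    have "jet_D K R \<infinity> i g \<in> jet_closure_ideal K R \<infinity> \<aa> \<mm>" if g: "g \<in> PIdl\<^bsub>R\<^esub> f" for g i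
    proof (rule mono[OF car[OF fR g]])
      show "jet_D K R (enat i) i g \<in> jet_closure_ideal K R (enat i) \<aa> \<mm>"
        using f g by (simp add: iff)
    qed simp_all
    with fR show "f \<in> arc_closure K R \<mm> \<aa>"
      by (simp add: arc_closure_def iff)
  next
    fix f assume f: "f \<in> arc_closure K R \<mm> \<aa>"
    then have fR: "f \<in> carrier R" by (simp add: arc_closure_def iff)
    have "jet_D K R (enat m) i g \<in> jet_closure_ideal K R (enat m) \<aa> \<mm>"
      if g: "g \<in> PIdl\<^bsub>R\<^esub> f" and i: "i \<le> m" for g i m
    proof (rule mono[OF car[OF fR g]])
      show "jet_D K R \<infinity> i g \<in> jet_closure_ideal K R \<infinity> \<aa> \<mm>"
        using f g by (simp add: arc_closure_def iff)
    qed (use i in simp_all)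
    with fR show "f \<in> (\<Inter>m::nat. jet_closure K R \<mm> (enat m) \<aa>)"
      by (simp add: iff)
  qed
qed

end
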